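(* Let $s\ge 1$, $n\ge 1$ and $i\ge 0$ be integers. Let $P_i(s,n)$ be the set of pairs $(D,R)$ where $D$ is a dissection of a convex $(sn+2)$-gon by $i$ pairwise non-crossing diagonals into polygons each having $sj+2$ sides for some $1\le j\le n-1$, and $R$ is one of the regions of $D$. Then there is a bijection between $P_i(s,n)$ and the Cartesian product of the set of all integer sequences $1\le a_1\le a_2\le\dots\le a_i\le sn+2$ and the set of all sequences $(\epsilon_1,\dots,\epsilon_{n-1})\in\{0,1\}^{n-1}$ with exactly $i$ entries equal to $1$.
   Context: The vertices $v_1,\dots,v_{sn+2}$ of the convex polygon are labeled cyclically anti-clockwise. A dissection by $i$ non-crossing diagonals divides the polygon into $i+1$ regions; the specified region $R$ is called the base region.
   Formalization: For i = 0 the bound 1 ≤ j ≤ n−1 is replaced by 1 ≤ j ≤ n, since otherwise the undissected (sn+2)-gon is excluded, P_0(s,n) is empty, and the claim fails because the product has one element. *)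

theory Defs
  imports Main
begin

(* The vertices of the convex N-gon are represented by their labels 1,...,N in cyclic order.
   More generally a set S of labels with at least three elements stands for the convex polygon
   spanned by the vertices with labels in S.  A chord between two vertices is represented by
   the pair of its end points, smaller label first. *)

definition chords :: "nat set \<Rightarrow> (nat \<times> nat) set" where
  "chords S = {(a, b). a \<in> S \<and> b \<in> S \<and> a < b}"

(* The vertices other than a and b lie on two arcs: the labels strictly between a and b, and the
   remaining ones.  The chord (a, b) is a side iff one of these arcs is empty. *)
definition polygon_sides :: "nat set \<Rightarrow> (nat \<times> nat) set" where
  "polygon_sides S = {(a, b) \<in> chords S.
     (\<forall>c\<in>S. \<not> (a < c \<and> c < b)) \<or> (\<forall>c\<in>S. \<not> (c < a \<or> b < c))}"

definition polygon_diagonals :: "nat set \<Rightarrow> (nat \<times> nat) set" where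
  "polygon_diagonals S = chords S - polygon_sides S"

(* In a convex polygon two chords meet in their relative interiors iff they are equal or their
   end points are distinct and alternate in the cyclic order; equal chords do not count as
   crossing, nor do chords with a common end point. *)
definition crossing :: "nat \<times> nat \<Rightarrow> nat \<times> nat \<Rightarrow> bool" where
  "crossing d e \<longleftrightarrow>
     fst d < fst e \<and> fst e < snd d \<and> snd d < snd e \<or>
     fst e < fst d \<and> fst d < snd e \<and> snd e < snd d"

definition dissection :: "nat \<Rightarrow> (nat \<times> nat) set \<Rightarrow> bool" where
  "dissection N D \<longleftrightarrow>
     D \<subseteq> polygon_diagonals {1..N} \<and> (\<forall>d\<in>D. \<forall>e\<in>D. \<not> crossing d e)"

(* The regions of a dissection are the polygons which are bounded by sides of the N-gon and
   diagonals of the dissection, and which no diagonal of the dissection cuts any further.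
   (A diagonal of D running through the inside of such a polygon without being one of its
   diagonals would cross one of its sides.) *)
definition regions :: "nat \<Rightarrow> (nat \<times> nat) set \<Rightarrow> nat set set" where
  "regions N D = {S. S \<subseteq> {1..N} \<and> card S \<ge> 3 \<and>
     polygon_sides S \<subseteq> polygon_sides {1..N} \<union> D \<and>
     polygon_diagonals S \<inter> D = {}}"

(* For i = 0 the only region is the whole (s * n + 2)-gon, for which j = n; hence the bound
   j \<le> n - 1 is imposed only when at least one diagonal is drawn. *)
definition based_dissections ::
  "nat \<Rightarrow> nat \<Rightarrow> nat \<Rightarrow> ((nat \<times> nat) set \<times> nat set) set" where
  "based_dissections i s n = {(D, R).
     dissection (s * n + 2) D \<and> card D = i \<and>
     (\<forall>S \<in> regions (s * n + 2) D.
        \<exists>j. 1 \<le> j \<and> j \<le> (if i = 0 then n else n - 1) \<and> card (polygon_sides S) = s * j + 2) \<and>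
     R \<in> regions (s * n + 2) D}"

definition weakly_increasing_seqs :: "nat \<Rightarrow> nat \<Rightarrow> nat list set" where
  "weakly_increasing_seqs i m = {as. length as = i \<and> sorted as \<and> set as \<subseteq> {1..m}}"

definition binary_seqs :: "nat \<Rightarrow> nat \<Rightarrow> nat list set" where
  "binary_seqs m i = {es. length es = m \<and> set es \<subseteq> {0, 1} \<and> count_list es 1 = i}"

end

theory Submission
  imports Defs Complex_Main
begin

text \<open>
  Both sides are finite, so it suffices to count. Add the side \<open>(1, N)\<close> to a dissection of the
  \<open>N\<close>-gon. Then the regions correspond to the arcs: the region of an arc is spanned by the vertices
  below it that no smaller arc covers. Count, more generally, noncrossing sets of \<open>i\<close> arcs in which
  the region of every arc has \<open>s * j + 2\<close> vertices for some \<open>j \<ge> 1\<close> and exactly \<open>h + 1\<close> of the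
  vertices \<open>1, \<dots>, N\<close> are covered by no arc. If no arc ends at \<open>N\<close>, delete the vertex \<open>N\<close>; otherwise
  delete the longest arc ending at \<open>N\<close>. This gives
  \<open>F(N, i, h) = F(N - 1, i, h - 1) + (\<Sum>j\<ge>1. F(N, i - 1, h + s * j))\<close>, whose solution for
  \<open>N - 1 = h + s * n\<close> is \<open>h / (N - 1)\<close> times \<open>(N - 1 + i - 1) choose i\<close> times the number of
  compositions of \<open>n\<close> into \<open>i\<close> parts. Dissections with \<open>i\<close> diagonals are the case \<open>h = 1\<close> with
  \<open>i + 1\<close> arcs, and each of them has \<open>i + 1\<close> regions to choose a base from.
\<close>

declare One_nat_def [simp del]

section \<open>Noncrossing arcs and their cells\<close>

definition noncrossing :: "(nat \<times> nat) set \<Rightarrow> bool" where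
  "noncrossing D \<longleftrightarrow> (\<forall>d\<in>D. \<forall>e\<in>D. \<not> crossing d e)"

text \<open>The pair \<open>(1, N)\<close> is kept although it is a side of the
  \<open>N\<close>-gon: it serves as the arc above the region that contains this side.\<close>

definition arcs :: "nat \<Rightarrow> (nat \<times> nat) set" where
  "arcs N = {(a, b). 1 \<le> a \<and> a + 2 \<le> b \<and> b \<le> N}"

definition visible :: "nat \<Rightarrow> nat \<Rightarrow> (nat \<times> nat) set \<Rightarrow> nat set" where
  "visible a b D = {v \<in> {a..b}. \<forall>(c, e)\<in>D. \<not> (c < v \<and> v < e)}"

text \<open>The arc \<open>d\<close> itself is dropped, since it would cover every vertex strictly
  below it.\<close>

definition inner :: "(nat \<times> nat) set \<Rightarrow> nat \<times> nat \<Rightarrow> (nat \<times> nat) set" where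
  "inner D d = {(c, e) \<in> D. (c, e) \<noteq> d \<and> fst d \<le> c \<and> e \<le> snd d}"

definition cell :: "(nat \<times> nat) set \<Rightarrow> nat \<times> nat \<Rightarrow> nat set" where
  "cell D d = visible (fst d) (snd d) (inner D d)"

text \<open>In increasing order the visible vertices form a path from \<open>1\<close> to
  \<open>N\<close> whose steps join neighbours or are maximal arcs. The height \<open>h\<close>
  counts these steps, hence \<open>h + 1\<close> vertices.\<close>

definition forests :: "nat \<Rightarrow> nat \<Rightarrow> nat \<Rightarrow> nat \<Rightarrow> (nat \<times> nat) set set" where
  "forests s N i h = {D. D \<subseteq> arcs N \<and> noncrossing D \<and> card D = i \<and>
     card (visible 1 N D) = h + 1 \<and> (\<forall>d\<in>D. \<exists>j\<ge>1. card (cell D d) = s * j + 2)}"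

lemma noncrossingD:
  "noncrossing D \<Longrightarrow> (a, b) \<in> D \<Longrightarrow> (c, e) \<in> D \<Longrightarrow> a < c \<Longrightarrow> c < b \<Longrightarrow> b < e \<Longrightarrow> False"
  unfolding noncrossing_def crossing_def by force

lemma noncrossing_subset: "noncrossing D \<Longrightarrow> D' \<subseteq> D \<Longrightarrow> noncrossing D'"
  unfolding noncrossing_def by blast

lemma finite_arcs: "finite (arcs N)"
  by (rule finite_subset[of _ "{..N} \<times> {..N}"]) (auto simp: arcs_def)

lemma finite_visible: "finite (visible a b D)"
  by (auto simp: visible_def)

lemma inner_subset: "inner D d \<subseteq> D"
  by (auto simp: inner_def)

text \<open>Some arc covers \<open>u + 1\<close>, and it must start at \<open>u\<close> because
  \<open>u\<close> is visible. The longest arc from \<open>u\<close> ends at a visible vertex, which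
  can only be \<open>w\<close>.\<close>

lemma visible_gap:
  assumes nc: "noncrossing D" and u: "u \<in> visible a b D" and w: "w \<in> visible a b D"
    and uw: "u + 2 \<le> w" and gap: "\<And>v. v \<in> visible a b D \<Longrightarrow> u < v \<Longrightarrow> w \<le> v"
  shows "(u, w) \<in> D"
proof -
  have "u + 1 \<notin> visible a b D"
    using gap[of "u + 1"] uw by auto
  moreover have ab: "a \<le> u" "w \<le> b"
    using u w by (auto simp: visible_def)
  ultimately obtain c e where ce: "(c, e) \<in> D" "c < u + 1" "u + 1 < e"
    using uw by (auto simp: visible_def)
  have "c = u"
    using u ce by (force simp: visible_def)
  \<comment> \<open>Right ends of the arcs from \<open>u\<close>; they are bounded by
    \<open>w\<close>, because a longer arc would cover \<open>w\<close>.\<close>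
  define E where "E = {e. (u, e) \<in> D \<and> u < e}"
  have E: "e \<in> E"
    using ce \<open>c = u\<close> by (auto simp: E_def)
  have Ew: "x \<le> w" if "x \<in> E" for x
    using that w uw by (force simp: visible_def E_def)
  then have fin: "finite E"
    by (meson finite_nat_set_iff_bounded_le)
  define m where "m = Max E"
  have m: "m \<in> E" and mmax: "\<And>x. x \<in> E \<Longrightarrow> x \<le> m"
    unfolding m_def using fin E by (auto intro: Max_in)
  then have um: "(u, m) \<in> D" "u < m"
    by (auto simp: E_def)
  have "m \<in> visible a b D"
  proof -
    \<comment> \<open>An arc covering \<open>m\<close> would cover \<open>u\<close>, or start at
      \<open>u\<close> and be longer than \<open>(u, m)\<close>, or cross
      \<open>(u, m)\<close>.\<close>
    have False if "(c', e') \<in> D" "c' < m" "m < e'" for c' e'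
    proof -
      consider "c' < u" | "c' = u" | "u < c'" by linarith
      then show False
      proof cases
        case 1
        then show ?thesis using u that um by (force simp: visible_def)
      next
        case 2
        then have "e' \<in> E" using that um by (auto simp: E_def)
        then show ?thesis using mmax[of e'] that by auto
      next
        case 3
        then show ?thesis using noncrossingD[OF nc um(1) that(1)] that by auto
      qed
    qed
    then show ?thesis
      using ab um Ew[OF m] by (auto simp: visible_def)
  qed
  then have "m = w"
    using gap um Ew[OF m] by (meson antisym)
  then show ?thesis
    using um by simp
qed

lemma endpoints_visible:
  assumes "D \<subseteq> arcs N" "1 \<le> N"
  shows "1 \<in> visible 1 N D" "N \<in> visible 1 N D"
  using assms by (auto simp: visible_def arcs_def)

lemma cell_endpoints:
  assumes "a \<le> b"
  shows "a \<in> cell D (a, b)" "b \<in> cell D (a, b)"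
  using assms by (auto simp: cell_def visible_def inner_def)

lemma cell_bounds: "v \<in> cell D (a, b) \<Longrightarrow> a \<le> v \<and> v \<le> b"
  by (auto simp: cell_def visible_def)

lemma finite_cell: "finite (cell D d)"
  by (simp add: cell_def finite_visible)

text \<open>Otherwise \<open>a\<close> and \<open>b\<close> would be consecutive visible vertices,
  and \<open>visible_gap\<close> would produce \<open>(a, b)\<close> among its own inner
  arcs.\<close>

lemma cell_middle:
  assumes "noncrossing D" "a + 2 \<le> b"
  shows "\<exists>v\<in>cell D (a, b). a < v \<and> v < b"
proof (rule ccontr)
  assume no: "\<not> ?thesis"
  have "(a, b) \<in> inner D (a, b)"
  proof (rule visible_gap)
    show "noncrossing (inner D (a, b))"
      using noncrossing_subset[OF assms(1) inner_subset] .
    show "a \<in> visible a b (inner D (a, b))" "b \<in> visible a b (inner D (a, b))"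
      using cell_endpoints[of a b D] assms by (auto simp: cell_def)
    show "a + 2 \<le> b" by fact
    show "b \<le> v" if "v \<in> visible a b (inner D (a, b))" "a < v" for v
      using that no by (auto simp: cell_def not_le)
  qed
  then show False
    by (auto simp: inner_def)
qed

section \<open>Regions of a dissection\<close>

lemma polygon_sides_iff:
  "(a, b) \<in> polygon_sides S \<longleftrightarrow> a \<in> S \<and> b \<in> S \<and> a < b \<and>
     ((\<forall>c\<in>S. c \<le> a \<or> b \<le> c) \<or> (\<forall>c\<in>S. a \<le> c \<and> c \<le> b))"
  unfolding polygon_sides_def chords_def by (auto simp: not_less not_le)

lemma polygon_diagonals_iff:
  "(a, b) \<in> polygon_diagonals S \<longleftrightarrow> a \<in> S \<and> b \<in> S \<and> a < b \<and> (a, b) \<notin> polygon_sides S"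
  by (auto simp: polygon_diagonals_def chords_def)

lemma polygon_sides_interval:
  "(a, b) \<in> polygon_sides {1..N} \<longleftrightarrow> 1 \<le> a \<and> a < b \<and> b \<le> N \<and> (b = a + 1 \<or> a = 1 \<and> b = N)"
proof -
  have "b = a + 1" if "\<forall>c\<in>{1..N}. c \<le> a \<or> b \<le> c" "a < b" "b \<le> N"
    using that(1)[rule_format, of "a + 1"] that(2,3) by auto
  moreover have "a = 1 \<and> b = N" if "\<forall>c\<in>{1..N}. a \<le> c \<and> c \<le> b" "1 \<le> a" "a < b" "b \<le> N"
    using that(1)[rule_format, of 1] that(1)[rule_format, of N] that(2-) by auto
  ultimately show ?thesis
    unfolding polygon_sides_iff by auto
qed

lemma polygon_diagonals_interval:
  "polygon_diagonals {1..N} = arcs N - {(1, N)}"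
  by (auto simp: polygon_diagonals_iff polygon_sides_interval arcs_def)

text \<open>Each vertex is sent to the side leading to its successor, and the largest one to the
  closing side \<open>(m, M)\<close>.\<close>

lemma card_polygon_sides:
  assumes fin: "finite S" and card: "3 \<le> card S"
  shows "card (polygon_sides S) = card S"
proof -
  define m M where "m = Min S" and "M = Max S"
  define next_vertex where "next_vertex v = Min {w \<in> S. v < w}" for v
  define f where "f v = (if v = M then (m, M) else (v, next_vertex v))" for v
  have ne: "S \<noteq> {}"
    using card by auto
  have mM: "m \<in> S" "M \<in> S" "\<And>v. v \<in> S \<Longrightarrow> m \<le> v \<and> v \<le> M"
    using fin ne by (auto simp: m_def M_def)
  have nxt: "next_vertex v \<in> S" "v < next_vertex v" "\<And>w. w \<in> S \<Longrightarrow> v < w \<Longrightarrow> next_vertex v \<le> w"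
    if "v \<in> S" "v \<noteq> M" for v
  proof -
    have "M \<in> {w \<in> S. v < w}"
      using that mM by (auto simp: order_less_le)
    then have "next_vertex v \<in> {w \<in> S. v < w}"
      unfolding next_vertex_def using fin by (intro Min_in) auto
    then show "next_vertex v \<in> S" "v < next_vertex v" by auto
    show "next_vertex v \<le> w" if "w \<in> S" "v < w" for w
      unfolding next_vertex_def using fin that by (intro Min_le) auto
  qed
  \<comment> \<open>With three or more vertices the closing side is not also a side from a vertex to
    its successor, so \<open>f\<close> does not hit it twice.\<close>
  have not_closing: "\<not> (v = m \<and> next_vertex v = M)" if "v \<in> S" "v \<noteq> M" for v
  proof
    assume *: "v = m \<and> next_vertex v = M"
    have "S \<subseteq> {m, M}"
      using nxt(3)[OF that] mM(3) * by (force simp: order_less_le)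
    then show False
      using card card_mono[of "{m, M}" S] by (simp add: card_insert_if split: if_splits)
  qed
  have "inj_on f S"
    using not_closing by (auto simp: inj_on_def f_def split: if_splits)
  moreover have "f ` S = polygon_sides S"
  proof (intro equalityI subsetI)
    fix d assume "d \<in> f ` S"
    then obtain v where v: "v \<in> S" "d = f v" by auto
    show "d \<in> polygon_sides S"
    proof (cases "v = M")
      case True
      have "m \<noteq> M"
      proof
        assume "m = M"
        then have "S \<subseteq> {m}" using mM(3) by force
        then show False using card card_mono[of "{m}" S] by auto
      qed
      then show ?thesis
        using v True mM by (auto simp: f_def polygon_sides_iff order_less_le)
    next
      case False
      then show ?thesis
        using v nxt[OF v(1) False] by (auto simp: f_def polygon_sides_iff not_le)
    qed
  next
    fix d assume "d \<in> polygon_sides S"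
    then obtain a b where d: "d = (a, b)" "(a, b) \<in> polygon_sides S"
      by (cases d) auto
    then have ab: "a \<in> S" "b \<in> S" "a < b"
      by (auto simp: polygon_sides_iff)
    from d consider "\<forall>c\<in>S. c \<le> a \<or> b \<le> c" | "\<forall>c\<in>S. a \<le> c \<and> c \<le> b"
      by (auto simp: polygon_sides_iff)
    then show "d \<in> f ` S"
    proof cases
      case 1
      have "a \<noteq> M" using ab mM by force
      moreover from this have "next_vertex a = b"
        using nxt[OF ab(1)] 1 ab by (metis le_antisym not_le)
      ultimately show ?thesis using ab d by (auto simp: f_def)
    next
      case 2
      then have "a = m" "b = M" using mM ab by (auto intro: antisym)
      then show ?thesis using ab d by (force simp: f_def)
    qed
  qed
  ultimately show ?thesis
    using card_image by metis
qed

lemma cell_consecutive: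
  assumes nc: "noncrossing D" and "u \<in> cell D d" "w \<in> cell D d" "u < w"
    and gap: "\<And>v. v \<in> cell D d \<Longrightarrow> u < v \<Longrightarrow> w \<le> v"
  shows "w = u + 1 \<or> (u, w) \<in> inner D d"
  using visible_gap[OF noncrossing_subset[OF nc inner_subset], of u "fst d" "snd d" d w] assms
  by (fastforce simp: cell_def)

lemma card_cell_ge_3:
  assumes "noncrossing D" "a + 2 \<le> b"
  shows "3 \<le> card (cell D (a, b))"
proof -
  obtain v where "v \<in> cell D (a, b)" "a < v" "v < b"
    using cell_middle[OF assms] by blast
  then have "{a, v, b} \<subseteq> cell D (a, b)" "card {a, v, b} = 3"
    using cell_endpoints[of a b D] by auto
  then show ?thesis
    using card_mono[OF finite_cell] by metis
qed

text \<open>An arc can be read off its cell as the pair of least and largest elements.\<close>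

lemma inj_on_cell: "D \<subseteq> arcs N \<Longrightarrow> inj_on (cell D) D"
proof (rule inj_onI, clarify)
  fix a b c e assume "D \<subseteq> arcs N" "(a, b) \<in> D" "(c, e) \<in> D" "cell D (a, b) = cell D (c, e)"
  then have "a \<in> cell D (c, e)" "b \<in> cell D (c, e)" "c \<in> cell D (a, b)" "e \<in> cell D (a, b)"
    using cell_endpoints[of a b D] cell_endpoints[of c e D] by (auto simp: arcs_def)
  then show "a = c \<and> b = e"
    using cell_bounds by (meson antisym)
qed

lemma dissection_closure:
  assumes "dissection N D" "3 \<le> N"
  shows "insert (1, N) D \<subseteq> arcs N" "noncrossing (insert (1, N) D)"
proof -
  have D: "D \<subseteq> arcs N - {(1, N)}"
    using assms unfolding dissection_def polygon_diagonals_interval by blast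
  then show "insert (1, N) D \<subseteq> arcs N"
    using assms by (auto simp: arcs_def)
  have "\<not> crossing (1, N) d \<and> \<not> crossing d (1, N)" if "d \<in> D" for d
    using D that by (auto simp: crossing_def arcs_def)
  then show "noncrossing (insert (1, N) D)"
    using assms(1) by (simp add: noncrossing_def dissection_def) (simp add: crossing_def)
qed

text \<open>A region is the cell of the arc joining its least and largest vertices. This pair is a
  side of the region, hence an arc of \<open>D'\<close>.\<close>

lemma regions_eq_cells:
  assumes D: "dissection N D" and N: "3 \<le> N"
  defines "D' \<equiv> insert (1, N) D"
  shows "regions N D = cell D' ` D'"
proof (intro equalityI subsetI)
  have arcs: "D' \<subseteq> arcs N" and nc: "noncrossing D'"
    using dissection_closure[OF D N] by (auto simp: D'_def)
  have sides: "(a, b) \<in> polygon_sides {1..N} \<union> D \<longleftrightarrow> 1 \<le> a \<and> a < b \<and> b \<le> N \<and> (b = a + 1 \<or> (a, b) \<in> D')"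
    for a b
    using arcs N unfolding D'_def by (auto simp: polygon_sides_interval arcs_def)
  {
    fix S assume "S \<in> cell D' ` D'"
    then obtain a b where ab: "(a, b) \<in> D'" "S = cell D' (a, b)" by auto
    then have le: "1 \<le> a" "a + 2 \<le> b" "b \<le> N"
      using arcs by (auto simp: arcs_def)
    have ends: "a \<in> S" "b \<in> S" and bounds: "\<And>v. v \<in> S \<Longrightarrow> a \<le> v \<and> v \<le> b"
      using cell_endpoints[of a b D'] cell_bounds[of _ D' a b] le ab by auto
    have "S \<subseteq> {1..N}"
      using bounds le by force
    moreover have "3 \<le> card S"
      using card_cell_ge_3[OF nc le(2)] ab by simp
    moreover have "polygon_sides S \<subseteq> polygon_sides {1..N} \<union> D"
    proof
      fix d assume "d \<in> polygon_sides S"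
      then obtain u w where d: "d = (u, w)" "(u, w) \<in> polygon_sides S" by (cases d) auto
      then have uw: "u \<in> S" "w \<in> S" "u < w" by (auto simp: polygon_sides_iff)
      from d consider "\<forall>c\<in>S. c \<le> u \<or> w \<le> c" | "\<forall>c\<in>S. u \<le> c \<and> c \<le> w"
        by (auto simp: polygon_sides_iff)
      then have "w = u + 1 \<or> (u, w) \<in> D'"
      proof cases
        case 1
        then show ?thesis
          using cell_consecutive[OF nc, of u "(a, b)" w] uw ab inner_subset
          by (metis not_le subsetD)
      next
        case 2
        then have "u = a" "w = b" using ends uw bounds by (auto intro: antisym)
        then show ?thesis using ab by simp
      qed
      moreover have "1 \<le> u" "w \<le> N"
        using bounds[OF uw(1)] bounds[OF uw(2)] le by auto
      ultimately show "d \<in> polygon_sides {1..N} \<union> D"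
        using sides[of u w] d(1) uw(3) by blast
    qed
    moreover have "polygon_diagonals S \<inter> D = {}"
    proof -
      have False if "(u, w) \<in> polygon_diagonals S" "(u, w) \<in> D" for u w
      proof -
        have uw: "u \<in> S" "w \<in> S" "u < w" "(u, w) \<notin> polygon_sides S"
          using that by (auto simp: polygon_diagonals_iff)
        then obtain c where c: "c \<in> S" "u < c" "c < w"
          by (auto simp: polygon_sides_iff not_le)
        \<comment> \<open>So a diagonal of \<open>S\<close> lying in \<open>D\<close> is an inner
          arc, and it would cover the vertex \<open>c\<close> of the cell.\<close>
        have "(u, w) \<noteq> (a, b)"
          using uw bounds by (auto simp: polygon_sides_iff)
        then have "(u, w) \<in> inner D' (a, b)"
          using that uw bounds by (auto simp: inner_def D'_def)
        then show False
          using c ab by (auto simp: cell_def visible_def)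
      qed
      then show ?thesis by auto
    qed
    ultimately show "S \<in> regions N D"
      by (simp add: regions_def)
  }
  {
    fix S assume "S \<in> regions N D"
    then have S: "S \<subseteq> {1..N}" "3 \<le> card S" and
      Ssides: "polygon_sides S \<subseteq> polygon_sides {1..N} \<union> D" and
      Sdiag: "polygon_diagonals S \<inter> D = {}"
      by (auto simp: regions_def)
    have fin: "finite S" using S finite_subset by blast
    have ne: "S \<noteq> {}" using S by auto
    define a b where "a = Min S" and "b = Max S"
    have ab: "a \<in> S" "b \<in> S" and bounds: "\<And>v. v \<in> S \<Longrightarrow> a \<le> v \<and> v \<le> b"
      using fin ne by (auto simp: a_def b_def)
    have "\<not> S \<subseteq> {a, b}"
      using S(2) card_mono[of "{a, b}" S] by (auto simp: card_insert_if split: if_splits)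
    \<comment> \<open>The third vertex \<open>x\<close> keeps \<open>a\<close> and \<open>b\<close>
      from being neighbours, so that \<open>side_arc\<close> applies to
      \<open>(a, b)\<close>.\<close>
    then obtain x where x: "x \<in> S" "a < x" "x < b"
      using bounds by (auto simp: order_less_le)
    have side_arc: "(u, w) \<in> D'" if "(u, w) \<in> polygon_sides S" "w \<noteq> u + 1" for u w
      using that Ssides sides by blast
    \<comment> \<open>A label skipped by \<open>S\<close> lies under the side joining the two
      vertices of \<open>S\<close> around it. This side is longer than one step, hence an
      arc.\<close>
    have consecutive: "\<exists>u\<in>S. \<exists>w\<in>S. u < v \<and> v < w \<and> (u, w) \<in> D' \<and> (\<forall>c\<in>S. c \<le> u \<or> w \<le> c)"
      if "v \<notin> S" "a \<le> v" "v \<le> b" for v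
    proof -
      define L U where "L = {u \<in> S. u < v}" and "U = {w \<in> S. v < w}"
      have ne: "a \<in> L" "b \<in> U" using that ab by (auto simp: L_def U_def order_less_le)
      have finLU: "finite L" "finite U" using fin by (auto simp: L_def U_def)
      have "Max L \<in> L" "Min U \<in> U"
        using Max_in[OF finLU(1)] Min_in[OF finLU(2)] ne by auto
      moreover have "c \<le> Max L \<or> Min U \<le> c" if "c \<in> S" for c
      proof (cases "c < v")
        case True
        then show ?thesis using Max_ge[OF finLU(1), of c] that by (simp add: L_def)
      next
        case False
        then have "c \<in> U" using that \<open>v \<notin> S\<close> by (auto simp: U_def order_less_le)
        then show ?thesis using Min_le[OF finLU(2)] by simp
      qed
      ultimately have *: "Max L \<in> S" "Min U \<in> S" "Max L < v" "v < Min U" "\<forall>c\<in>S. c \<le> Max L \<or> Min U \<le> c"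
        by (auto simp: L_def U_def)
      then have "(Max L, Min U) \<in> D'"
        by (intro side_arc) (auto simp: polygon_sides_iff)
      then show ?thesis using * by blast
    qed
    have "(a, b) \<in> D'"
      using ab bounds x by (intro side_arc) (auto simp: polygon_sides_iff)
    moreover have "S = cell D' (a, b)"
    proof (intro equalityI subsetI)
      fix v assume v: "v \<in> S"
      \<comment> \<open>If an end of such an arc were outside \<open>S\<close>, the side of
        \<open>S\<close> above that end would cross the arc. With both ends in \<open>S\<close> the
        arc is a diagonal of \<open>S\<close> in \<open>D\<close>, which a region excludes.\<close>
      have False if ce: "(c, e) \<in> D'" "(c, e) \<noteq> (a, b)" "a \<le> c" "e \<le> b" "c < v" "v < e" for c e
      proof -
        have "c \<in> S"
        proof (rule ccontr)
          assume "c \<notin> S"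
          then obtain u w where uw: "u < c" "c < w" "(u, w) \<in> D'" "\<forall>x\<in>S. x \<le> u \<or> w \<le> x"
            using consecutive[of c] ce bounds[OF v] by auto
          then have "w < e"
            using ce v by force
          then show False
            using noncrossingD[OF nc uw(3) ce(1) uw(1,2)] by simp
        qed
        moreover have "e \<in> S"
        proof (rule ccontr)
          assume "e \<notin> S"
          then obtain u w where uw: "u < e" "e < w" "(u, w) \<in> D'" "\<forall>x\<in>S. x \<le> u \<or> w \<le> x"
            using consecutive[of e] ce bounds[OF v] by auto
          then have "c < u"
            using ce v by force
          then show False
            using noncrossingD[OF nc ce(1) uw(3) _ uw(1,2)] by simp
        qed
        moreover have "(c, e) \<notin> polygon_sides S"
          using ce v ab by (force simp: polygon_sides_iff)
        moreover have "(c, e) \<in> D"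
          using ce S(1) ab unfolding D'_def by force
        moreover have "c < e"
          using ce by simp
        ultimately have "(c, e) \<in> polygon_diagonals S \<inter> D"
          unfolding polygon_diagonals_iff Int_iff by blast
        then show False
          using Sdiag by blast
      qed
      then show "v \<in> cell D' (a, b)"
        using bounds[OF v] by (auto simp: cell_def visible_def inner_def)
    next
      fix v assume v: "v \<in> cell D' (a, b)"
      show "v \<in> S"
      proof (rule ccontr)
        assume "v \<notin> S"
        then obtain u w where uw: "u \<in> S" "w \<in> S" "u < v" "v < w" "(u, w) \<in> D'"
          "\<forall>c\<in>S. c \<le> u \<or> w \<le> c"
          using consecutive[of v] cell_bounds[OF v] by blast
        then have "(u, w) \<in> inner D' (a, b)"
          using bounds x by (auto simp: inner_def)
        then show False
          using v uw by (auto simp: cell_def visible_def)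
      qed
    qed
    ultimately show "S \<in> cell D' ` D'" by blast
  }
qed

section \<open>Adding and removing an outer arc\<close>

text \<open>As \<open>b\<close> is visible, no old arc passes over it, so \<open>(b, N)\<close>
  crosses nothing. It becomes the longest arc ending at \<open>N\<close>, hides the visible vertices
  strictly below it, and these together with its end points form its cell.\<close>

lemma add_arc:
  assumes D: "D \<subseteq> arcs N" "noncrossing D"
    and b: "b \<in> visible 1 N D" "b + 2 \<le> N" and new: "(b, N) \<notin> D"
  defines "D' \<equiv> insert (b, N) D"
  shows "D' \<subseteq> arcs N" "noncrossing D'"
    and "visible 1 N D' = visible 1 N D - {b<..<N}"
    and "cell D' (b, N) = visible 1 N D \<inter> {b..N}"
    and "d \<in> D \<Longrightarrow> cell D' d = cell D d"
    and "(c, N) \<in> D' \<Longrightarrow> b \<le> c"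
proof -
  have b1: "1 \<le> b" and uncovered: "\<And>c e. (c, e) \<in> D \<Longrightarrow> c < b \<Longrightarrow> e \<le> b"
    using b by (auto simp: visible_def not_less)
  have le: "c + 2 \<le> e" "e \<le> N" if "(c, e) \<in> D" for c e
    using D that by (auto simp: arcs_def)
  show "D' \<subseteq> arcs N"
    using D b b1 by (auto simp: D'_def arcs_def)
  have "\<not> crossing (b, N) d \<and> \<not> crossing d (b, N)" if "d \<in> D" for d
    using uncovered[of "fst d" "snd d"] le[of "fst d" "snd d"] that by (auto simp: crossing_def)
  then show "noncrossing D'"
    using D by (auto simp: D'_def noncrossing_def crossing_def)
  show "visible 1 N D' = visible 1 N D - {b<..<N}"
    by (auto simp: D'_def visible_def)
  have "(c, e) \<in> inner D' (b, N)" if "(c, e) \<in> D" "c < v" "v < e" "b \<le> v" for c e v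
    using that uncovered[of c e] le[of c e] new by (force simp: inner_def D'_def)
  moreover have "inner D' (b, N) \<subseteq> D"
    by (auto simp: inner_def D'_def)
  ultimately show "cell D' (b, N) = visible 1 N D \<inter> {b..N}"
    using b1 unfolding cell_def visible_def by (auto; fastforce)
  show least: "b \<le> c" if "(c, N) \<in> D'" for c
    using that uncovered[of c N] b by (fastforce simp: D'_def)
  show "cell D' d = cell D d" if "d \<in> D"
  proof -
    \<comment> \<open>An old arc around \<open>(b, N)\<close> would end at \<open>N\<close>, hence
      start at \<open>b\<close> by \<open>least\<close> and coincide with the new arc.\<close>
    have "\<not> (fst d \<le> b \<and> N \<le> snd d)"
      using that new least[of "fst d"] le[of "fst d" "snd d"] by (cases d) (force simp: D'_def)
    then have "inner D' d = inner D d"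
      by (auto simp: inner_def D'_def)
    then show ?thesis
      by (simp add: cell_def)
  qed
qed

text \<open>A remaining arc over \<open>b\<close> cannot end at \<open>N\<close>, as
  \<open>b\<close> is the least left end there, and if it ended before \<open>N\<close> it would
  cross \<open>(b, N)\<close>.\<close>

lemma outer_arc_visible:
  assumes "D \<subseteq> arcs N" "noncrossing D" "(b, N) \<in> D" "\<And>c. (c, N) \<in> D \<Longrightarrow> b \<le> c"
  shows "b \<in> visible 1 N (D - {(b, N)})"
proof -
  have "e \<le> b" if "(c, e) \<in> D" "c < b" for c e
  proof (rule ccontr)
    assume "\<not> e \<le> b"
    moreover have "e < N"
      using that assms(1,4) by (force simp: arcs_def order_less_le)
    ultimately show False
      using noncrossingD[OF assms(2) that(1) assms(3)] that by simp
  qed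
  then show ?thesis
    using assms(1,3) by (force simp: visible_def arcs_def)
qed

text \<open>The elements \<open>b\<close> and \<open>N\<close> are counted in both parts, hence the
  \<open>2\<close>.\<close>

lemma card_cut_interval:
  fixes U :: "nat set"
  assumes "finite U" "b \<in> U" "N \<in> U" "b < N"
  shows "card (U - {b<..<N}) + card (U \<inter> {b..N}) = card U + 2"
proof -
  have "card U = card (U - {b<..<N}) + card (U \<inter> {b<..<N})"
    using assms card_Int_Diff[of U "{b<..<N}"] by simp
  moreover have "U \<inter> {b..N} = insert b (insert N (U \<inter> {b<..<N}))"
    using assms by auto
  then have "card (U \<inter> {b..N}) = card (U \<inter> {b<..<N}) + 2"
    using assms by simp
  ultimately show ?thesis by simp
qed

text \<open>Finds the left end of a new arc from the intended size of its cell. The induction adds a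
  new minimum, which leaves the segments above older elements unchanged.\<close>

lemma ex_upper_segment:
  fixes U :: "nat set"
  assumes "finite U" "1 \<le> k" "k \<le> card U"
  shows "\<exists>b\<in>U. card (U \<inter> {b..}) = k"
  using assms
proof (induction U rule: finite_linorder_min_induct)
  case empty
  then show ?case by simp
next
  case (insert m U)
  show ?case
  proof (cases "k \<le> card U")
    case True
    then obtain b where "b \<in> U" "card (U \<inter> {b..}) = k"
      using insert by auto
    moreover have "insert m U \<inter> {b..} = U \<inter> {b..}"
      using insert \<open>b \<in> U\<close> by force
    ultimately show ?thesis by (metis insertI2)
  next
    case False
    then have "k = card (insert m U)"
      using insert.prems insert.hyps by (auto simp: card_insert_if)
    moreover have "insert m U \<inter> {m..} = insert m U"
      using insert by force
    ultimately show ?thesis by (metis insertI1)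
  qed
qed

lemma upper_segment_unique:
  fixes U :: "nat set"
  assumes "finite U" "b \<in> U" "c \<in> U" "b \<le> N" "c \<le> N" "card (U \<inter> {b..N}) = card (U \<inter> {c..N})"
  shows "b = c"
proof -
  have "False" if "b < c" "b \<in> U" "b \<le> N" "card (U \<inter> {b..N}) = card (U \<inter> {c..N})" for b c
  proof -
    have "b \<in> U \<inter> {b..N}" "b \<notin> U \<inter> {c..N}" "U \<inter> {c..N} \<subseteq> U \<inter> {b..N}"
      using that by auto
    moreover from this have "U \<inter> {c..N} = U \<inter> {b..N}"
      using assms(1) that(4) by (intro card_subset_eq) auto
    ultimately show False
      by simp
  qed
  then show ?thesis
    using assms by (metis linorder_neqE_nat)
qed

section \<open>The recursion for the number of forests\<close>

lemma finite_forests: "finite (forests s N i h)"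
  by (rule finite_subset[of _ "Pow (arcs N)"]) (auto simp: forests_def finite_arcs)

text \<open>If no arc ends at the last vertex, that vertex is visible and lies in no cell; deleting
  it only lowers the height by one.\<close>

lemma forests_without_last:
  assumes "1 \<le> N"
  shows "{D \<in> forests s (Suc N) i (Suc h). Suc N \<notin> snd ` D} = forests s N i h"
proof -
  have arcs: "D \<subseteq> arcs (Suc N) \<and> Suc N \<notin> snd ` D \<longleftrightarrow> D \<subseteq> arcs N" for D
    by (force simp: arcs_def le_Suc_eq)
  have "card (visible 1 (Suc N) D) = Suc (card (visible 1 N D))" if "D \<subseteq> arcs N" for D
  proof -
    have "visible 1 (Suc N) D = insert (Suc N) (visible 1 N D)"
      using that assms by (force simp: visible_def arcs_def le_Suc_eq)
    moreover have "Suc N \<notin> visible 1 N D"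
      by (auto simp: visible_def)
    ultimately show ?thesis
      by (simp add: finite_visible)
  qed
  note vis = this
  have "D \<in> forests s (Suc N) i (Suc h) \<and> Suc N \<notin> snd ` D \<longleftrightarrow> D \<in> forests s N i h" for D
  proof (cases "D \<subseteq> arcs N")
    case True
    then have "D \<subseteq> arcs (Suc N)" "Suc N \<notin> snd ` D"
      using arcs[of D] by blast+
    then show ?thesis
      using True vis[OF True] by (simp add: forests_def)
  next
    case False
    then show ?thesis
      using arcs[of D] by (auto simp only: forests_def mem_Collect_eq)
  qed
  then show ?thesis by blast
qed

text \<open>Only meaningful if some arc of \<open>D\<close> ends at \<open>N\<close>.\<close>
definition outer :: "nat \<Rightarrow> (nat \<times> nat) set \<Rightarrow> nat" where
  "outer N D = Min {b. (b, N) \<in> D}"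

lemma outer_arc:
  assumes "D \<subseteq> arcs N" "N \<in> snd ` D"
  shows "(outer N D, N) \<in> D" "(c, N) \<in> D \<Longrightarrow> outer N D \<le> c"
proof -
  have "finite {b. (b, N) \<in> D}"
    by (rule finite_subset[of _ "{..N}"]) (use assms in \<open>auto simp: arcs_def\<close>)
  moreover have "{b. (b, N) \<in> D} \<noteq> {}"
    using assms(2) by force
  ultimately show "(outer N D, N) \<in> D" "(c, N) \<in> D \<Longrightarrow> outer N D \<le> c"
    using Min_in[of "{b. (b, N) \<in> D}"] Min_le[of "{b. (b, N) \<in> D}" c] by (auto simp: outer_def)
qed

text \<open>The \<open>s * j\<close> vertices of the cell other than its two end points become
  visible, so the height grows by \<open>s * j\<close>.\<close>

lemma forests_remove_outer:
  assumes D: "D \<in> forests s N (Suc i) h" "N \<in> snd ` D"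
  defines "b \<equiv> outer N D"
  defines "D' \<equiv> D - {(b, N)}"
  shows "\<exists>j\<ge>1. card (cell D (b, N)) = s * j + 2 \<and> card (visible 1 N D' \<inter> {b..N}) = s * j + 2 \<and>
    b \<in> visible 1 N D' \<and> D' \<in> forests s N i (h + s * j)"
proof -
  have arcs: "D \<subseteq> arcs N" and nc: "noncrossing D" and card: "card D = Suc i"
    and vis: "card (visible 1 N D) = h + 1" and cells: "\<forall>d\<in>D. \<exists>j\<ge>1. card (cell D d) = s * j + 2"
    using D by (auto simp: forests_def)
  note bD = outer_arc[OF arcs D(2), folded b_def]
  have b2: "b + 2 \<le> N" "1 \<le> N" using arcs bD(1) by (auto simp: arcs_def)
  have b: "b \<in> visible 1 N D'"
    unfolding D'_def using outer_arc_visible[OF arcs nc bD] .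
  have arcs': "D' \<subseteq> arcs N" and nc': "noncrossing D'" and new: "(b, N) \<notin> D'"
    and DD': "D = insert (b, N) D'" and fin: "finite D"
    using arcs noncrossing_subset[OF nc] bD(1) card card.infinite by (fastforce simp: D'_def)+
  \<comment> \<open>Deletion is analysed backwards: \<open>D\<close> arises from \<open>D'\<close>
    by adding the arc \<open>(b, N)\<close>.\<close>
  note add = add_arc[OF arcs' nc' b b2(1) new, folded DD']
  obtain j where j: "1 \<le> j" "card (cell D (b, N)) = s * j + 2"
    using cells bD(1) by auto
  have "card (visible 1 N D') = h + s * j + 1"
    using card_cut_interval[OF finite_visible b endpoints_visible(2)[OF arcs' b2(2)]] vis j b2
    by (simp add: add(3,4))
  moreover have "card D' = i"
    using card fin bD(1) by (simp add: D'_def)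
  moreover have "\<exists>j\<ge>1. card (cell D' d) = s * j + 2" if "d \<in> D'" for d
  proof -
    have "d \<in> D" using that by (simp add: D'_def)
    then have "\<exists>j\<ge>1. card (cell D d) = s * j + 2"
      using cells by blast
    then show ?thesis
      by (simp only: add(5)[OF that])
  qed
  ultimately have "D' \<in> forests s N i (h + s * j)"
    using arcs' nc' by (auto simp: forests_def)
  then show ?thesis
    using j b add(4) by auto
qed

text \<open>Inverse of the deletion: the last \<open>s * j + 2\<close> visible vertices become the
  cell of the new arc.\<close>

lemma forests_add_outer:
  assumes D: "D \<in> forests s N i (h + s * j)" and "1 \<le> s" "1 \<le> j" "1 \<le> h" "1 \<le> N"
  shows "\<exists>b. (b, N) \<notin> D \<and> insert (b, N) D \<in> forests s N (Suc i) h \<and> outer N (insert (b, N) D) = b \<and>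
    card (cell (insert (b, N) D) (b, N)) = s * j + 2"
proof -
  have arcs: "D \<subseteq> arcs N" and nc: "noncrossing D" and card: "card D = i"
    and vis: "card (visible 1 N D) = h + s * j + 1" and cells: "\<forall>d\<in>D. \<exists>j\<ge>1. card (cell D d) = s * j + 2"
    using D by (auto simp: forests_def)
  \<comment> \<open>There are enough visible vertices because \<open>1 \<le> h\<close>.\<close>
  obtain b where b: "b \<in> visible 1 N D" "card (visible 1 N D \<inter> {b..}) = s * j + 2"
    using ex_upper_segment[OF finite_visible[of 1 N D], of "s * j + 2"] vis assms by auto
  moreover have "visible 1 N D \<inter> {b..} = visible 1 N D \<inter> {b..N}"
    by (auto simp: visible_def)
  ultimately have card_seg: "card (visible 1 N D \<inter> {b..N}) = s * j + 2"
    by simp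
  have "1 \<le> s * j" using assms by (metis mult_le_mono nat_mult_1)
  then have b2: "b + 2 \<le> N"
    using card_seg card_mono[of "{b..N}" "visible 1 N D \<inter> {b..N}"] by simp
  have new: "(b, N) \<notin> D"
  proof
    assume "(b, N) \<in> D"
    \<comment> \<open>An arc \<open>(b, N)\<close> already present would leave only its end points
      visible from \<open>b\<close> on, but the segment has at least three vertices.\<close>
    then have "visible 1 N D \<inter> {b..N} \<subseteq> {b, N}"
      by (force simp: visible_def)
    then have "s * j + 2 \<le> card {b, N}"
      unfolding card_seg[symmetric] by (intro card_mono) auto
    moreover have "card {b, N} \<le> 2"
      by (simp add: card_insert_if)
    ultimately show False
      using \<open>1 \<le> s * j\<close> by linarith
  qed
  define D' where "D' = insert (b, N) D"
  note add = add_arc[OF arcs nc b(1) b2 new, folded D'_def]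
  have "N \<in> snd ` D'" by (force simp: D'_def)
  then have "outer N D' = b"
    using outer_arc[OF add(1)] add(6) by (auto simp: D'_def intro: antisym)
  moreover have "card (visible 1 N D') = h + 1"
    using card_cut_interval[OF finite_visible b(1) endpoints_visible(2)[OF arcs \<open>1 \<le> N\<close>]] vis card_seg b2
    by (simp add: add(3))
  moreover have "card D' = Suc i"
    using card new finite_subset[OF arcs finite_arcs] by (simp add: D'_def)
  moreover have "\<exists>j\<ge>1. card (cell D' d) = s * j + 2" if "d \<in> D'" for d
  proof (cases "d \<in> D")
    case True
    then show ?thesis
      using cells by (simp only: add(5)[OF True])
  next
    case False
    then show ?thesis
      using that add(4) card_seg \<open>1 \<le> j\<close> unfolding D'_def by (metis insertE)
  qed
  ultimately have "D' \<in> forests s N (Suc i) h"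
    using add(1,2) by (auto simp: forests_def)
  then show ?thesis
    using new \<open>outer N D' = b\<close> add(4) card_seg by (auto simp: D'_def)
qed

text \<open>Deleting the outer arc while recording \<open>j\<close> is a bijection onto the disjoint
  union over \<open>j\<close>; the bound on \<open>N\<close> leaves no forests for
  \<open>j > n\<close>.\<close>

lemma card_forests_with_last:
  assumes "1 \<le> s" "1 \<le> h" "1 \<le> N" and N: "N \<le> h + s * n + 1"
  shows "card {D \<in> forests s N (Suc i) h. N \<in> snd ` D} = (\<Sum>j=1..n. card (forests s N i (h + s * j)))"
proof -
  let ?A = "{D \<in> forests s N (Suc i) h. N \<in> snd ` D}"
  let ?B = "Sigma {1..n} (\<lambda>j. forests s N i (h + s * j))"
  define f where "f D = ((card (cell D (outer N D, N)) - 2) div s, D - {(outer N D, N)})" for D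
  have "inj_on f ?A"
  proof (rule inj_onI)
    fix D E assume D: "D \<in> ?A" and E: "E \<in> ?A" and eq: "f D = f E"
    define D' where "D' = D - {(outer N D, N)}"
    obtain j where j: "card (cell D (outer N D, N)) = s * j + 2"
      "card (visible 1 N D' \<inter> {outer N D..N}) = s * j + 2" "outer N D \<in> visible 1 N D'"
      using forests_remove_outer[of D s N i h] D unfolding D'_def by blast
    have E': "D' = E - {(outer N E, N)}"
      using eq by (simp add: f_def D'_def)
    then obtain k where k: "card (cell E (outer N E, N)) = s * k + 2"
      "card (visible 1 N D' \<inter> {outer N E..N}) = s * k + 2" "outer N E \<in> visible 1 N D'"
      using forests_remove_outer[of E s N i h] E by auto
    have "j = k"
      using eq j(1) k(1) assms(1) by (simp add: f_def)
    \<comment> \<open>Equal \<open>j\<close> means equally many visible vertices of the common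
      remainder from the left end on, which fixes that end.\<close>
    then have "outer N D = outer N E"
      using upper_segment_unique[OF finite_visible j(3) k(3), of N] j k by (auto simp: visible_def)
    moreover have "(outer N D, N) \<in> D" "(outer N E, N) \<in> E"
      using outer_arc(1) D E by (auto simp: forests_def)
    then have "insert (outer N D, N) D' = D" "insert (outer N E, N) D' = E"
      by (simp add: D'_def insert_absorb) (simp add: E' insert_absorb \<open>(outer N E, N) \<in> E\<close>)
    ultimately show "D = E"
      by metis
  qed
  moreover have "f ` ?A = ?B"
  proof (intro equalityI subsetI)
    fix p assume "p \<in> f ` ?A"
    then obtain D where D: "D \<in> ?A" "p = f D" by (rule imageE)
    obtain j where j: "1 \<le> j" "card (cell D (outer N D, N)) = s * j + 2"
      "D - {(outer N D, N)} \<in> forests s N i (h + s * j)"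
      using forests_remove_outer[of D s N i h] D(1) by auto
    have "card (visible 1 N (D - {(outer N D, N)})) \<le> card {1..N}"
      by (intro card_mono) (auto simp: visible_def)
    then have "h + s * j + 1 \<le> N"
      using j(3) by (simp add: forests_def)
    then have "s * j \<le> s * n" using N by linarith
    then have "j \<le> n" using assms(1) by simp
    then show "p \<in> ?B"
      using D j assms(1) by (simp add: f_def)
  next
    fix p assume "p \<in> ?B"
    then obtain j D where p: "p = (j, D)" "1 \<le> j" "j \<le> n" "D \<in> forests s N i (h + s * j)" by auto
    obtain b where b: "(b, N) \<notin> D" "insert (b, N) D \<in> forests s N (Suc i) h"
      "outer N (insert (b, N) D) = b" "card (cell (insert (b, N) D) (b, N)) = s * j + 2"
      using forests_add_outer[OF p(4) assms(1) p(2) assms(2,3)] by blast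
    then have "p = f (insert (b, N) D)"
      using p assms(1) by (simp add: f_def)
    moreover have "insert (b, N) D \<in> ?A"
      using b by auto
    ultimately show "p \<in> f ` ?A" by blast
  qed
  ultimately have "card ?A = card ?B"
    using card_image[of f ?A] by simp
  then show ?thesis
    by (simp add: finite_forests)
qed

section \<open>Counting forests\<close>

text \<open>Number of ordered sums of \<open>i\<close> positive integers with total
  \<open>n\<close>. The case \<open>n = 0\<close> is separate because \<open>n - 1\<close>
  truncates.\<close>

fun compositions :: "nat \<Rightarrow> nat \<Rightarrow> nat" where
  "compositions 0 n = (if n = 0 then 1 else 0)"
| "compositions (Suc i) n = (if n = 0 then 0 else (n - 1) choose i)"

text \<open>Pascal's rule: the last part exceeds \<open>1\<close> or equals
  \<open>1\<close>.\<close>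

lemma compositions_Suc: "compositions (Suc i) (Suc n) = compositions (Suc i) n + compositions i n"
  by (cases n; cases i) auto

lemma sum_compositions: "(\<Sum>m<n. compositions i m) = compositions (Suc i) n"
proof (induction n)
  case (Suc n)
  then show ?case by (simp add: compositions_Suc del: compositions.simps)
qed simp

lemma compositions_absorb: "n * compositions (Suc i) n + Suc i * compositions (Suc i) (Suc n) =
   Suc n * compositions (Suc i) (Suc n)"
proof (cases n)
  case (Suc k)
  have "Suc i * (Suc k choose i) + Suc k * (k choose i) = Suc (Suc k) * (Suc k choose i)"
  proof (cases i)
    case (Suc l)
    have "Suc l * (Suc k choose Suc l) = Suc k * (k choose l)"
      using Suc_times_binomial_eq[of k l] by simp
    then show ?thesis using Suc by (simp add: algebra_simps)
  qed simp
  then show ?thesis using Suc by simp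
qed (cases i; simp)

text \<open>The sum adds up the last part \<open>n - m\<close> over all compositions of
  \<open>n\<close> into \<open>Suc i\<close> parts. By symmetry every part has the same total, and
  all parts together give \<open>n\<close> per composition.\<close>

lemma weighted_sum_compositions:
  "Suc i * (\<Sum>m<n. (n - m) * compositions i m) = n * compositions (Suc i) n"
proof (induction n)
  case (Suc n)
  have "(\<Sum>m<Suc n. (Suc n - m) * compositions i m) =
      (\<Sum>m<n. (n - m) * compositions i m) + (\<Sum>m<Suc n. compositions i m)"
    by (simp add: sum.distrib[symmetric] Suc_diff_le add.commute)
  then have "Suc i * (\<Sum>m<Suc n. (Suc n - m) * compositions i m) =
      n * compositions (Suc i) n + Suc i * compositions (Suc i) (Suc n)"
    unfolding sum_compositions by (simp only: distrib_left Suc.IH)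
  then show ?case
    by (simp only: compositions_absorb)
qed simp

lemma sum_compositions_reverse:
  "(\<Sum>j=1..n. g j * compositions i (n - j)) = (\<Sum>m<n. g (n - m) * compositions i m)"
  by (rule sum.reindex_bij_witness[of _ "\<lambda>m. n - m" "\<lambda>j. n - j"]) auto

section \<open>The closed formula for the number of forests\<close>

lemma forests_height_0: "2 \<le> N \<Longrightarrow> forests s N i 0 = {}"
proof -
  assume N: "2 \<le> N"
  have False if "D \<in> forests s N i 0" for D
  proof -
    have "{1, N} \<subseteq> visible 1 N D" "card (visible 1 N D) = 1"
      using that endpoints_visible[of D N] N by (auto simp: forests_def)
    then show False
      using card_mono[OF finite_visible[of 1 N D], of "{1, N}"] N by simp
  qed
  then show ?thesis by blast
qed

lemma forests_without_arcs: "forests s (Suc x) 0 h = (if h = x then {{}} else {})"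
proof -
  have "visible 1 (Suc x) {} = {1..Suc x}"
    by (auto simp: visible_def)
  moreover have "D = {}" if "D \<in> forests s (Suc x) 0 h" for D
    using that finite_subset[OF _ finite_arcs, of D "Suc x"] by (simp add: forests_def)
  moreover have "{} \<in> forests s (Suc x) 0 h \<longleftrightarrow> card (visible 1 (Suc x) {}) = h + 1"
    by (auto simp: forests_def noncrossing_def)
  ultimately show ?thesis
    by auto
qed

text \<open>The closed formula with denominators cleared; \<open>pochhammer x i\<close> is
  \<open>fact i\<close> times \<open>(x + i - 1) choose i\<close>. The outer induction on
  \<open>i\<close> handles the sum in the recursion, the inner one on \<open>h\<close> the forests
  on one vertex less.\<close>

lemma card_forests:
  assumes s: "1 \<le> s" and x: "x = h + s * n"
  shows "fact i * x * card (forests s (Suc x) i h) = h * pochhammer x i * compositions i n"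
  using x
proof (induction i arbitrary: x h n)
  case 0
  then show ?case using s by (auto simp: forests_without_arcs)
next
  case (Suc i)
  note IH = Suc.IH
  show ?case
    using Suc.prems
  proof (induction h arbitrary: x)
    case 0
    have "x = 0 \<or> forests s (Suc x) (Suc i) 0 = {}"
      using forests_height_0[of "Suc x"] by auto
    then show ?case by auto
  next
    case (Suc h)
    define y c where "y = h + s * n" and "c = compositions (Suc i) n"
    have x: "x = Suc y" using Suc.prems by (simp add: y_def)
    let ?F = "\<lambda>i h. card (forests s (Suc x) i h)"
    have split: "?F (Suc i) (Suc h) = card (forests s x (Suc i) h) + (\<Sum>j=1..n. ?F i (Suc h + s * j))"
    proof -
      have "?F (Suc i) (Suc h) =
          card {D \<in> forests s (Suc x) (Suc i) (Suc h). Suc x \<notin> snd ` D} +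
          card {D \<in> forests s (Suc x) (Suc i) (Suc h). Suc x \<in> snd ` D}"
        by (subst card_Un_disjoint[symmetric]) (auto intro!: arg_cong[where f = card] simp: finite_forests)
      then show ?thesis
        using x Suc.prems card_forests_with_last[OF s, of "Suc h" "Suc x" n i]
        by (simp add: forests_without_last)
    qed
    \<comment> \<open>The inner hypothesis divided by \<open>y\<close>, which is the first factor of
      \<open>pochhammer y (Suc i)\<close>. For \<open>y = 0\<close> also \<open>h = 0\<close>, and a
      single vertex carries no arcs.\<close>
    have first: "fact (Suc i) * card (forests s x (Suc i) h) = h * pochhammer x i * c"
    proof (cases "y = 0")
      case True
      then have "arcs x = {}" using x by (auto simp: arcs_def)
      then have "forests s x (Suc i) h = {}" by (auto simp: forests_def)
      then show ?thesis using True by (simp add: y_def)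
    next
      case False
      have "y * (fact (Suc i) * card (forests s x (Suc i) h)) = y * (h * pochhammer x i * c)"
        using Suc.IH[OF y_def] unfolding x c_def pochhammer_rec by (simp only: ac_simps Suc_eq_plus1)
      then show ?thesis using False by simp
    qed
    have "x * (fact (Suc i) * (\<Sum>j=1..n. ?F i (Suc h + s * j))) =
        Suc i * (\<Sum>j=1..n. fact i * x * ?F i (Suc h + s * j))"
      unfolding fact_Suc of_nat_id sum_distrib_left by (simp only: ac_simps)
    also have "\<dots> = Suc i * (\<Sum>j=1..n. (Suc h + s * j) * pochhammer x i * compositions i (n - j))"
    proof (rule arg_cong[where f = "(*) (Suc i)"], rule sum.cong[OF refl], rule IH)
      \<comment> \<open>The removed cell uses up \<open>j\<close> of the \<open>n\<close> units, so
        the hypothesis is applied with \<open>n - j\<close> and the raised height.\<close>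
      fix j assume "j \<in> {1..n}"
      then have "s * n = s * j + s * (n - j)"
        by (simp add: distrib_left[symmetric])
      then show "x = Suc h + s * j + s * (n - j)"
        using Suc.prems by simp
    qed
    also have "\<dots> = pochhammer x i * (Suc i * (\<Sum>j=1..n. (Suc h + s * j) * compositions i (n - j)))"
      by (simp only: sum_distrib_left ac_simps)
    also have "(\<Sum>j=1..n. (Suc h + s * j) * compositions i (n - j)) =
        (\<Sum>m<n. (Suc h + s * (n - m)) * compositions i m)"
      by (rule sum_compositions_reverse)
    also have "(\<Sum>m<n. (Suc h + s * (n - m)) * compositions i m) =
        Suc h * (\<Sum>m<n. compositions i m) + s * (\<Sum>m<n. (n - m) * compositions i m)"
      unfolding sum_distrib_left sum.distrib[symmetric] by (simp only: distrib_right mult.assoc)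
    also have "Suc i * \<dots> = Suc i * Suc h * c + s * (n * c)"
      unfolding distrib_left sum_compositions c_def weighted_sum_compositions[symmetric]
      by (simp only: ac_simps)
    finally have second: "x * (fact (Suc i) * (\<Sum>j=1..n. ?F i (Suc h + s * j))) =
        pochhammer x i * (Suc i * Suc h * c + s * (n * c))" .
    have "fact (Suc i) * x * ?F (Suc i) (Suc h) =
        x * (fact (Suc i) * card (forests s x (Suc i) h)) + x * (fact (Suc i) * (\<Sum>j=1..n. ?F i (Suc h + s * j)))"
      unfolding split by (simp only: distrib_left ac_simps)
    also have "\<dots> = pochhammer x i * c * (x * h + Suc i * Suc h + s * n)"
      unfolding first second by (simp only: distrib_left ac_simps)
    \<comment> \<open>Substituting \<open>x = Suc h + s * n\<close>; the factor \<open>x + i\<close>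
      extends \<open>pochhammer x i\<close> by one step.\<close>
    also have "x * h + Suc i * Suc h + s * n = Suc h * (x + i)"
      using Suc.prems by (simp add: algebra_simps)
    finally show ?case
      unfolding c_def pochhammer_Suc of_nat_id by (simp only: ac_simps)
  qed
qed

section \<open>Counting the based dissections\<close>

lemma finite_weakly_increasing_seqs: "finite (weakly_increasing_seqs i m)"
  by (rule finite_subset[OF _ finite_lists_length_eq[of "{1..m}" i]])
    (auto simp: weakly_increasing_seqs_def)

lemma finite_binary_seqs: "finite (binary_seqs m i)"
  by (rule finite_subset[OF _ finite_lists_length_eq[of "{0, 1}" m]]) (auto simp: binary_seqs_def)

text \<open>Pascal's rule, according to whether the last entry is the largest admissible
  value.\<close>

lemma card_weakly_increasing_seqs: "card (weakly_increasing_seqs i (Suc m)) = (m + i) choose i"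
proof -
  have empty: "weakly_increasing_seqs 0 m = {[]}" for m
    by (auto simp: weakly_increasing_seqs_def)
  have split: "weakly_increasing_seqs (Suc i) (Suc m) =
      weakly_increasing_seqs (Suc i) m \<union> (\<lambda>xs. xs @ [Suc m]) ` weakly_increasing_seqs i (Suc m)" for i m
  proof (intro equalityI subsetI)
    fix ys assume ys: "ys \<in> weakly_increasing_seqs (Suc i) (Suc m)"
    then obtain xs x where x: "ys = xs @ [x]"
      by (cases ys rule: rev_cases) (auto simp: weakly_increasing_seqs_def)
    show "ys \<in> weakly_increasing_seqs (Suc i) m \<union> (\<lambda>xs. xs @ [Suc m]) ` weakly_increasing_seqs i (Suc m)"
    proof (cases "x = Suc m")
      case True
      then show ?thesis
        using ys x by (auto simp: weakly_increasing_seqs_def sorted_append)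
    next
      case False
      then have "\<forall>y\<in>set ys. y \<le> m"
        using ys x by (auto simp: weakly_increasing_seqs_def sorted_append le_Suc_eq)
      then show ?thesis
        using ys by (auto simp: weakly_increasing_seqs_def)
    qed
  qed (fastforce simp: weakly_increasing_seqs_def sorted_append)+
  have rec: "card (weakly_increasing_seqs (Suc i) (Suc m)) =
      card (weakly_increasing_seqs (Suc i) m) + card (weakly_increasing_seqs i (Suc m))" for i m
    unfolding split by (subst card_Un_disjoint)
      (auto simp: finite_weakly_increasing_seqs card_image inj_on_def, auto simp: weakly_increasing_seqs_def)
  show ?thesis
  proof (induction i arbitrary: m)
    case 0
    then show ?case by (simp add: empty)
  next
    case (Suc i)
    note IH = Suc.IH
    show ?case
    proof (induction m)
      case 0
      have "weakly_increasing_seqs (Suc i) 0 = {}"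
        by (auto simp: weakly_increasing_seqs_def)
      then show ?case using rec[of i 0] IH[of 0] by simp
    next
      case (Suc m)
      then show ?case using rec[of i "Suc m"] IH[of "Suc m"] by simp
    qed
  qed
qed

lemma card_binary_seqs: "card (binary_seqs m i) = m choose i"
proof (induction m arbitrary: i)
  case 0
  have "binary_seqs 0 i = (if i = 0 then {[]} else {})"
    by (auto simp: binary_seqs_def)
  then show ?case by simp
next
  case (Suc m)
  have split: "binary_seqs (Suc m) i =
      (#) 0 ` binary_seqs m i \<union> (if i = 0 then {} else (#) 1 ` binary_seqs m (i - 1))"
    by (auto simp: binary_seqs_def length_Suc_conv image_iff split: if_splits)
  show ?case
  proof (cases i)
    case 0
    then show ?thesis unfolding split using Suc by (simp add: card_image)
  next
    case (Suc k)
    then have "binary_seqs (Suc m) i = (#) 0 ` binary_seqs m i \<union> (#) 1 ` binary_seqs m k"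
      using split by simp
    then have "card (binary_seqs (Suc m) i) = card ((#) (0::nat) ` binary_seqs m i) + card ((#) (1::nat) ` binary_seqs m k)"
      by (simp only:) (subst card_Un_disjoint; auto simp: finite_binary_seqs)
    then show ?thesis using Suc Suc.IH by (simp add: card_image)
  qed
qed

section \<open>From forests back to based dissections\<close>

lemma fact_mult_pochhammer: "fact x * pochhammer (Suc x) i = (fact (x + i) :: nat)"
  by (induction i) (simp_all add: pochhammer_Suc algebra_simps)

text \<open>For \<open>h = 1\<close> the factor \<open>x\<close> cancels against the first factor of
  \<open>pochhammer x (Suc i)\<close>. The factor \<open>Suc i\<close> left from
  \<open>fact (Suc i)\<close> is the number of choices of a base region.\<close>

lemma card_forests_height_1:
  assumes "1 \<le> s" "1 \<le> n"
  shows "Suc i * card (forests s (s * n + 2) (Suc i) 1) = (s * n + 1 + i choose i) * (n - 1 choose i)"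
proof -
  define x where "x = 1 + s * n"
  let ?F = "card (forests s (s * n + 2) (Suc i) 1)"
  have "fact x * pochhammer (Suc x) i = (fact x * (fact i * (x + i choose i)) :: nat)"
    unfolding fact_mult_pochhammer using binomial_fact_lemma[of i "x + i"] by (simp add: ac_simps)
  then have poch: "pochhammer (Suc x) i = fact i * (x + i choose i)"
    by simp
  have "fact (Suc i) * x * ?F = pochhammer x (Suc i) * (n - 1 choose i)"
  proof -
    have "s * n + 2 = Suc x" "compositions (Suc i) n = (n - 1 choose i)"
      using assms(2) by (simp_all add: x_def)
    then show ?thesis
      using card_forests[OF assms(1) x_def, of "Suc i"] by (simp only: mult_1)
  qed
  then have "(fact i * x) * (Suc i * ?F) = (fact i * x) * ((x + i choose i) * (n - 1 choose i))"
    unfolding pochhammer_rec fact_Suc of_nat_id using poch by (simp only: Suc_eq_plus1 ac_simps)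
  then show ?thesis
    by (simp add: x_def add.commute)
qed

text \<open>Adding \<open>(1, N)\<close> hides all vertices but \<open>1\<close> and
  \<open>N\<close>, which gives height \<open>1\<close>. Conversely, height \<open>1\<close> forces
  the arc \<open>(1, N)\<close> by \<open>visible_gap\<close>.\<close>

lemma bij_betw_dissections_forests:
  fixes N s n i :: nat
  assumes N: "N = s * n + 2" and "1 \<le> s" "1 \<le> n"
  defines "A \<equiv> {D. dissection N D \<and> card D = i \<and>
     (\<forall>S\<in>regions N D. \<exists>j. 1 \<le> j \<and> j \<le> (if i = 0 then n else n - 1) \<and>
        card (polygon_sides S) = s * j + 2)}"
  shows "bij_betw (insert (1, N)) A (forests s N (Suc i) 1)"
proof -
  have "1 \<le> s * n" using assms by (metis mult_le_mono nat_mult_1)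
  then have N3: "3 \<le> N" using N by simp
  have new: "(1, N) \<notin> D" if "dissection N D" for D
    using that unfolding dissection_def polygon_diagonals_interval by blast
  have sides: "card (polygon_sides S) = card S" if "S \<in> regions N D" for S D
    using that card_polygon_sides[of S] finite_subset[of S "{1..N}"] by (simp add: regions_def)
  have "inj_on (insert (1, N)) A"
    using new by (intro inj_on_inverseI[where g = "\<lambda>E. E - {(1, N)}"]) (simp add: A_def)
  moreover have "insert (1, N) ` A = forests s N (Suc i) 1"
  proof (intro equalityI subsetI)
    fix E assume "E \<in> insert (1, N) ` A"
    then obtain D where E: "E = insert (1, N) D" and D: "D \<in> A" by blast
    then have dis: "dissection N D" by (simp add: A_def)
    note closure = dissection_closure[OF dis N3, folded E]
    have "card E = Suc i"
      using D E new[OF dis] finite_subset[OF closure(1) finite_arcs] by (simp add: A_def)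
    moreover have "visible 1 N E = {1, N}"
      using E endpoints_visible[OF closure(1)] N3 by (auto simp: visible_def)
    moreover have "\<exists>j\<ge>1. card (cell E d) = s * j + 2" if "d \<in> E" for d
    proof -
      have "cell E d \<in> regions N D"
        unfolding regions_eq_cells[OF dis N3] E[symmetric] using that by (rule imageI)
      then show ?thesis
        using D sides[of "cell E d" D] by (force simp: A_def)
    qed
    ultimately show "E \<in> forests s N (Suc i) 1"
      using closure N3 by (simp add: forests_def)
  next
    fix E assume "E \<in> forests s N (Suc i) 1"
    then have arcs: "E \<subseteq> arcs N" and nc: "noncrossing E" and card: "card E = Suc i"
      and vis: "card (visible 1 N E) = 2" and cells: "\<forall>d\<in>E. \<exists>j\<ge>1. card (cell E d) = s * j + 2"
      by (auto simp: forests_def)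
    have ends: "1 \<in> visible 1 N E" "N \<in> visible 1 N E"
      using endpoints_visible[OF arcs] N3 by auto
    then have "{1, N} = visible 1 N E"
      using vis N3 by (intro card_subset_eq) (auto simp: finite_visible)
    from this[symmetric] have top: "(1, N) \<in> E"
      using N3 by (intro visible_gap[OF nc ends]) auto
    define D where "D = E - {(1, N)}"
    have E: "E = insert (1, N) D" using top by (auto simp: D_def)
    have dis: "dissection N D"
      using arcs nc unfolding dissection_def polygon_diagonals_interval noncrossing_def D_def by blast
    have cardD: "card D = i"
      using card top finite_subset[OF arcs finite_arcs] by (simp add: D_def)
    have "\<exists>j. 1 \<le> j \<and> j \<le> (if i = 0 then n else n - 1) \<and> card (polygon_sides S) = s * j + 2"
      if S: "S \<in> regions N D" for S
    proof -
      obtain j where j: "1 \<le> j" "card S = s * j + 2"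
        using S cells regions_eq_cells[OF dis N3] E by auto
      have sub: "S \<subseteq> {1..N}" and diag: "polygon_diagonals S \<inter> D = {}"
        using S by (auto simp: regions_def)
      have "card S \<le> N"
        using card_mono[OF _ sub] by simp
      then have "j \<le> n"
        using j N \<open>1 \<le> s\<close> by simp
      \<comment> \<open>For \<open>j = n\<close> the region would be the whole polygon; no diagonal
        of \<open>D\<close> cuts a region, so \<open>D\<close> would be empty.\<close>
      moreover have "j < n" if "i \<noteq> 0"
      proof -
        have "S \<noteq> {1..N}"
        proof
          assume "S = {1..N}"
          then have "D = {}"
            using diag dis unfolding dissection_def by blast
          then show False
            using cardD that by simp
        qed
        then have "card S < N"
          using psubset_card_mono[of "{1..N}" S] sub by auto
        then show ?thesis using j N by simp
      qed
      ultimately show ?thesis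
        using j sides[OF S] by (intro exI[of _ j]) auto
    qed
    then have "D \<in> A"
      using dis cardD by (simp add: A_def)
    then show "E \<in> insert (1, N) ` A"
      using E by blast
  qed
  ultimately show ?thesis
    by (simp add: bij_betw_def)
qed

text \<open>Cells are distinct for distinct arcs; the extra one belongs to
  \<open>(1, N)\<close>.\<close>

lemma card_regions:
  assumes "dissection N D" "3 \<le> N"
  shows "card (regions N D) = Suc (card D)"
proof -
  have "(1, N) \<notin> D" and "finite D"
    using assms finite_subset[OF _ finite_arcs, of D N]
    unfolding dissection_def polygon_diagonals_interval by auto
  then show ?thesis
    unfolding regions_eq_cells[OF assms]
    using card_image[OF inj_on_cell[OF dissection_closure(1)[OF assms]]] by simp
qed

lemma finite_based_dissections: "finite (based_dissections i s n)"
proof (rule finite_subset)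
  show "based_dissections i s n \<subseteq> Pow (arcs (s * n + 2)) \<times> Pow {1..s * n + 2}"
    unfolding based_dissections_def dissection_def polygon_diagonals_interval regions_def by blast
qed (simp add: finite_arcs)

theorem theorem1:
  fixes s n i :: nat
  assumes "s \<ge> 1" and "n \<ge> 1"
  shows "\<exists>f. bij_betw f (based_dissections i s n)
               (weakly_increasing_seqs i (s * n + 2) \<times> binary_seqs (n - 1) i)"
proof -
  define N where "N = s * n + 2"
  define A where "A = {D. dissection N D \<and> card D = i \<and>
     (\<forall>S\<in>regions N D. \<exists>j. 1 \<le> j \<and> j \<le> (if i = 0 then n else n - 1) \<and>
        card (polygon_sides S) = s * j + 2)}"
  have "1 \<le> s * n" using assms by (metis mult_le_mono nat_mult_1)
  then have N3: "3 \<le> N" by (simp add: N_def)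
  have bij: "bij_betw (insert (1, N)) A (forests s N (Suc i) 1)"
    unfolding A_def using bij_betw_dissections_forests[OF N_def assms] .
  then have finA: "finite A"
    using bij_betw_finite finite_forests by blast
  \<comment> \<open>The base is chosen independently for each dissection, so the count is a sum of
    numbers of regions, each equal to \<open>Suc i\<close>.\<close>
  have "based_dissections i s n = Sigma A (regions N)"
    by (auto simp: based_dissections_def A_def N_def)
  moreover have "finite (regions N D)" for D
    by (rule finite_subset[of _ "Pow {1..N}"]) (auto simp: regions_def)
  ultimately have "card (based_dissections i s n) = (\<Sum>D\<in>A. card (regions N D))"
    using finA by simp
  also have "\<dots> = (\<Sum>D\<in>A. Suc i)"
    using card_regions[OF _ N3] by (intro sum.cong) (auto simp: A_def)
  also have "\<dots> = Suc i * card (forests s N (Suc i) 1)"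
    using bij_betw_same_card[OF bij] by simp
  also have "\<dots> = (s * n + 1 + i choose i) * (n - 1 choose i)"
    unfolding N_def by (rule card_forests_height_1[OF assms])
  also have "\<dots> = card (weakly_increasing_seqs i (s * n + 2) \<times> binary_seqs (n - 1) i)"
  proof -
    have "s * n + 2 = Suc (s * n + 1)" by simp
    then show ?thesis
      by (simp only: card_cartesian_product card_binary_seqs card_weakly_increasing_seqs)
  qed
  finally show ?thesis
    by (intro finite_same_card_bij finite_based_dissections finite_cartesian_product
        finite_weakly_increasing_seqs finite_binary_seqs)
qed

end
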